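(* Assume that either of the following holds: (1) the controller is weakly communicating, and $Q$ and $\mathcal{P}_s$, for all $s\in S$, are compact; or (2) the controller is communicating and $Q$ is compact. Then the constant-gain average-reward robust Bellman equation $$u^*(s)=\sup_{\phi\in Q}\inf_{p_s\in\mathcal{P}_s}\sum_{a\in A}\sum_{s'\in S}\phi(a)p_s(s'|a)\big[r(s,a)-\alpha^*+u^*(s')\big]\qquad\forall s\in S$$ has a solution $(u^*,\alpha^* )$ with $u^*:S\to\mathbb{R}$ and $\alpha^*\in[0,1]$.
   Context: $S$ (states) and $A$ (actions) are finite nonempty sets; $\mathrm{Prob}(E)$ is the set of probability distributions on a finite set $E$; $r:S\times A\to[0,1]$ is a reward function. $Q\subseteq\mathrm{Prob}(A)$ is nonempty (controller's admissible randomized actions). For each $s\in S$, $\mathcal{P}_s$ is a nonempty set of maps $p_s:A\to\mathrm{Prob}(S)$, written $p_s(s'|a)$; $\mathcal{P}=\prod_{s\in S}\mathcal{P}_s$, and $p\in\mathcal{P}$ (a stationary adversary policy) is written $p(s'|s,a)=p_s(s'|a)$. Compactness is with respect to the Euclidean topology on $\mathbb{R}^{|A|}$, $\mathbb{R}^{|A|\times|S|}$. A stationary controller policy is a map $\Delta:S\to Q$, written $\Delta(a|s)$. For $p\in\mathcal{P}$ and $\Delta:S\to\mathrm{Prob}(A)$, $p_\Delta(s'|s)=\sum_{a\in A}p(s'|s,a)\Delta(a|s)$, and $p_\Delta^n(s'|s)$ is the $(s,s')$ entry of the $n$-th power of the matrix $p_\Delta$. A stationary controller policy $\Delta:S\to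 Q$ is weakly communicating if there is a set $C_\Delta\subseteq S$ (its communicating class) such that for any $s,s'\in C_\Delta$ there exist $p\in\mathcal{P}$ and $N\ge1$ with $p_\Delta^N(s'|s)>0$, and every $s\in S\setminus C_\Delta$ is transient for the Markov chain $p_\Delta$ for every $p\in\mathcal{P}$. $\Delta$ is communicating if this holds with $C_\Delta=S$. The controller is weakly communicating (resp. communicating) if every stationary policy $\Delta:S\to Q$ is weakly communicating (resp. communicating); the classes $C_\Delta$ may depend on $\Delta$. *)

theory Defs
  imports "HOL-Analysis.Analysis"
begin

definition prob_simplex :: "(real ^ 'e::finite) set"
  where "prob_simplex = {v. (\<forall>i. 0 \<le> v $ i) \<and> (\<Sum>i\<in>UNIV. v $ i) = 1}"

text \<open>An element \<open>q\<close> of type \<open>real ^ 's ^ 'a\<close> represents a map from actions to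
  vectors over states: \<open>q $ a $ s'\<close> is \<open>p\<^sub>s(s'|a)\<close>.  Compactness in this type, and in
  \<open>real ^ 'a\<close>, is with respect to the Euclidean topology.\<close>

definition transition_kernels :: "(real ^ 's::finite ^ 'a::finite) set"
  where "transition_kernels = {q. \<forall>a. q $ a \<in> prob_simplex}"

definition induced_chain ::
    "('s \<Rightarrow> real ^ 's ^ 'a) \<Rightarrow> ('s \<Rightarrow> real ^ 'a) \<Rightarrow> real ^ 's::finite ^ 's"
  where "induced_chain p \<Delta> = (\<chi> s s'. \<Sum>a\<in>(UNIV :: 'a::finite set). p s $ a $ s' * \<Delta> s $ a)"

text \<open>The overloaded \<open>*\<close> and \<open>^\<close> on \<open>real ^ 's ^ 's\<close> act componentwise, hence a separate
  power with respect to the matrix product.\<close>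

definition mat_power :: "real ^ 's::finite ^ 's \<Rightarrow> nat \<Rightarrow> real ^ 's ^ 's"
  where "mat_power M n = (((**) M) ^^ n) (mat 1)"

text \<open>\<open>first_passage M n x y\<close> is the probability that the chain with transition matrix
  \<open>M\<close>, started in \<open>x\<close>, visits \<open>y\<close> at time \<open>n\<close> but at none of the times
  \<open>1, \<dots>, n - 1\<close>; the recursion conditions on the first step.\<close>

fun first_passage :: "real ^ 's::finite ^ 's \<Rightarrow> nat \<Rightarrow> 's \<Rightarrow> 's \<Rightarrow> real" where
  "first_passage M 0 x y = 0"
| "first_passage M (Suc 0) x y = M $ x $ y"
| "first_passage M (Suc (Suc n)) x y =
     (\<Sum>z\<in>UNIV - {y}. M $ x $ z * first_passage M (Suc n) z y)"

text \<open>A state is transient if the probability of ever returning to it is less than one.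
  For stochastic \<open>M\<close> the series always converges, see \<open>summable_first_passage\<close>.\<close>

definition transient :: "real ^ 's::finite ^ 's \<Rightarrow> 's \<Rightarrow> bool"
  where "transient M s \<longleftrightarrow> (\<Sum>n. first_passage M n s s) < 1"

definition communicating_class ::
    "('s \<Rightarrow> (real ^ 's ^ 'a) set) \<Rightarrow> ('s \<Rightarrow> real ^ 'a::finite) \<Rightarrow> 's::finite set \<Rightarrow> bool"
  where "communicating_class P \<Delta> C \<longleftrightarrow>
    (\<forall>s\<in>C. \<forall>s'\<in>C. \<exists>p\<in>Pi UNIV P. \<exists>N\<ge>1. mat_power (induced_chain p \<Delta>) N $ s $ s' > 0) \<and>
    (\<forall>s\<in>- C. \<forall>p\<in>Pi UNIV P. transient (induced_chain p \<Delta>) s)"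

definition weakly_communicating_policy ::
    "('s \<Rightarrow> (real ^ 's ^ 'a) set) \<Rightarrow> ('s::finite \<Rightarrow> real ^ 'a::finite) \<Rightarrow> bool"
  where "weakly_communicating_policy P \<Delta> \<longleftrightarrow> (\<exists>C. communicating_class P \<Delta> C)"

definition communicating_policy ::
    "('s \<Rightarrow> (real ^ 's ^ 'a) set) \<Rightarrow> ('s::finite \<Rightarrow> real ^ 'a::finite) \<Rightarrow> bool"
  where "communicating_policy P \<Delta> \<longleftrightarrow> communicating_class P \<Delta> UNIV"

definition weakly_communicating_controller ::
    "(real ^ 'a) set \<Rightarrow> ('s \<Rightarrow> (real ^ 's::finite ^ 'a::finite) set) \<Rightarrow> bool"
  where "weakly_communicating_controller Q P \<longleftrightarrow>
    (\<forall>\<Delta>\<in>UNIV \<rightarrow> Q. weakly_communicating_policy P \<Delta>)"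

definition communicating_controller ::
    "(real ^ 'a) set \<Rightarrow> ('s \<Rightarrow> (real ^ 's::finite ^ 'a::finite) set) \<Rightarrow> bool"
  where "communicating_controller Q P \<longleftrightarrow>
    (\<forall>\<Delta>\<in>UNIV \<rightarrow> Q. communicating_policy P \<Delta>)"

lemma first_passage_nonneg:
  assumes "\<And>x. M $ x \<in> prob_simplex"
  shows "0 \<le> first_passage M n x y"
  using assms
proof (induction M n x y rule: first_passage.induct)
  case (3 M n x y)
  have "0 \<le> M $ x $ z" for z
    using 3(2) by (simp add: prob_simplex_def)
  moreover have "0 \<le> first_passage M (Suc n) z y" if "z \<in> UNIV - {y}" for z
    by (rule 3(1)[OF that 3(2)])
  ultimately show ?case
    by (auto intro!: sum_nonneg mult_nonneg_nonneg)
qed (simp_all add: prob_simplex_def)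

lemma sum_first_passage_le_1:
  fixes M :: "real ^ 's::finite ^ 's"
  assumes M: "\<And>x. M $ x \<in> prob_simplex"
  shows "(\<Sum>n\<le>N. first_passage M n x y) \<le> 1"
proof (induction N arbitrary: x)
  case 0
  show ?case by simp
next
  case (Suc N)
  have nn: "0 \<le> M $ x $ z" for z
    using M by (simp add: prob_simplex_def)
  have step: "first_passage M (Suc n) x y =
      (if n = 0 then M $ x $ y else 0) + (\<Sum>z\<in>UNIV - {y}. M $ x $ z * first_passage M n z y)" for n
    by (cases n) simp_all
  have "(\<Sum>n\<le>Suc N. first_passage M n x y) = (\<Sum>n\<le>N. first_passage M (Suc n) x y)"
    by (subst sum.atMost_Suc_shift) simp
  also have "\<dots> = M $ x $ y + (\<Sum>n\<le>N. \<Sum>z\<in>UNIV - {y}. M $ x $ z * first_passage M n z y)"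
    by (simp add: step sum.distrib)
  also have "\<dots> = M $ x $ y + (\<Sum>z\<in>UNIV - {y}. M $ x $ z * (\<Sum>n\<le>N. first_passage M n z y))"
    by (subst sum.swap) (simp add: sum_distrib_left)
  also have "\<dots> \<le> M $ x $ y + (\<Sum>z\<in>UNIV - {y}. M $ x $ z * 1)"
    by (intro add_left_mono sum_mono mult_left_mono Suc nn)
  also have "\<dots> = (\<Sum>z\<in>UNIV. M $ x $ z)"
    by (simp add: sum.remove[of UNIV y])
  also have "\<dots> = 1"
    using M by (simp add: prob_simplex_def)
  finally show ?case .
qed

lemma summable_first_passage:
  assumes "\<And>x. M $ x \<in> prob_simplex"
  shows "summable (\<lambda>n. first_passage M n x y)"
proof (rule summableI_nonneg_bounded)
  show "0 \<le> first_passage M n x y" for n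
    by (rule first_passage_nonneg[OF assms])
  show "(\<Sum>i<n. first_passage M i x y) \<le> 1" for n
  proof -
    have "(\<Sum>i<n. first_passage M i x y) \<le> (\<Sum>i\<le>n. first_passage M i x y)"
      by (rule sum_mono2) (auto intro: first_passage_nonneg[OF assms])
    also have "\<dots> \<le> 1"
      by (rule sum_first_passage_le_1[OF assms])
    finally show ?thesis .
  qed
qed

end

theory Submission
  imports Defs
begin

text \<open>
  The proof is by vanishing discount. Subtracting \<open>\<alpha>\<close> from the rewards is the same as
  subtracting it from \<open>u\<close>, so a solution is a pair with \<open>u = T (u - \<alpha>)\<close>, where \<open>T\<close> is the
  undiscounted robust operator. \<open>T\<close> is topical (monotone and commuting with constants), so
  for every \<open>\<lambda> < 1\<close> the discounted equation \<open>v = T (\<lambda> v)\<close> has a solution in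
  \<open>[0, 1 / (1 - \<lambda>)]\<close>. If the span \<open>max v - min v\<close> stays bounded along a
  sequence \<open>\<lambda> \<rightarrow> 1\<close>, then \<open>v - v s\<^sub>0\<close> and \<open>(1 - \<lambda>) v s\<^sub>0\<close> accumulate at a solution
  \<open>u\<close>, \<open>\<alpha>\<close> (\<open>topical_eigenvector_vanishing_discount\<close>).

  The communication hypotheses bound the span. A controller policy \<open>\<Delta>\<close> that is optimal up
  to 1 satisfies \<open>v \<le> 2 + p\<^sub>\<Delta> v\<close> for every adversary policy \<open>p\<close>, and an adversary reply that
  is optimal up to 1 satisfies \<open>p\<^sub>\<Delta> v \<le> v + 2\<close>. Iterating the first inequality \<open>k\<close>
  times shows the following: if \<open>x\<close> leads to \<open>y\<close> in \<open>k\<close> steps with a probability bounded away from 0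
  and \<open>v x\<close> is within a bounded distance of the maximum, then so is \<open>v y\<close>; the second inequality
  gives the same for the minimum (\<open>bounded_deficit_propagates\<close>). As \<open>Q\<close> is compact,
  the policies \<open>\<Delta>\<close> converge along a subsequence, so positive probabilities under the limit
  policy stay bounded away from 0 near the limit. Let \<open>C\<close> be the communicating class of the limit.
  The states outside \<open>C\<close> are transient, so every state leads to \<open>C\<close>
  (\<open>reaches_complement_of_transient\<close>). Hence the value is nearly maximal at some state of \<open>C\<close>,
  and then on all of \<open>C\<close>, because every pair in \<open>C\<close> is connected by some adversary.
  The minimum is compared with a value on \<open>C\<close> through the adversary's own replies, which
  converge along a further subsequence when the \<open>\<P>\<^sub>s\<close> are compact. When
  \<open>C\<close> is the whole state space, the minimiser lies in \<open>C\<close> already (\<open>bounded_span\<close>).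
\<close>

section \<open>Subsequences of finite families\<close>

lemma finite_family_convergent_subseq:
  fixes f :: "nat \<Rightarrow> 'i::finite \<Rightarrow> 'b::metric_space"
  assumes K: "\<And>i. compact (K i)" and f: "\<And>n i. f n i \<in> K i"
  obtains l g where "strict_mono g" "\<And>i. l i \<in> K i" "\<And>i. (\<lambda>n. f (g n) i) \<longlonglongrightarrow> l i"
proof -
  have "\<exists>l g. strict_mono g \<and> (\<forall>i\<in>I. l i \<in> K i \<and> (\<lambda>n. f (g n) i) \<longlonglongrightarrow> l i)" for I :: "'i set"
    using finite[of I]
  proof (induction I rule: finite_induct)
    case empty
    show ?case
      using strict_mono_id by auto
  next
    case (insert j I)
    then obtain l g where g: "strict_mono g"
      and l: "\<And>i. i \<in> I \<Longrightarrow> l i \<in> K i \<and> (\<lambda>n. f (g n) i) \<longlonglongrightarrow> l i"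
      by blast
    from K[of j] obtain y h where y: "y \<in> K j" and h: "strict_mono h"
      and lim: "((\<lambda>n. f (g n) j) \<circ> h) \<longlonglongrightarrow> y"
      unfolding compact_def using f by metis
    have "(\<lambda>n. f ((g \<circ> h) n) i) \<longlonglongrightarrow> l i" if "i \<in> I" for i
      using LIMSEQ_subseq_LIMSEQ[OF conjunct2[OF l[OF that]] h] by (simp add: o_def)
    then have "\<forall>i\<in>insert j I. (l(j := y)) i \<in> K i \<and> (\<lambda>n. f ((g \<circ> h) n) i) \<longlonglongrightarrow> (l(j := y)) i"
      using l y lim insert.hyps by (auto simp: o_def)
    then show ?case
      using strict_mono_o[OF g h] by blast
  qed
  from this[of UNIV] show thesis
    using that by blast
qed

lemma constant_subsequence:
  fixes f :: "nat \<Rightarrow> 'i::finite"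
  obtains g :: "nat \<Rightarrow> nat" and y where "strict_mono g" "\<And>n. f (g n) = y"
proof -
  obtain k where k: "infinite {n. f n = f k}"
    using pigeonhole_infinite[of "UNIV :: nat set" f] by auto
  show thesis
  proof (rule that)
    show "strict_mono (enumerate {n. f n = f k})"
      by (rule strict_mono_enumerate[OF k])
    show "f (enumerate {n. f n = f k} n) = f k" for n
      using enumerate_in_set[OF k, of n] by simp
  qed
qed

section \<open>Topical operators\<close>

text \<open>Quantifying over the constant \<open>c\<close> combines monotonicity (\<open>c = 0\<close>) and
  compatibility with constants in one condition that is easy to check for a sup-inf of averages.\<close>

definition topical :: "(('s \<Rightarrow> real) \<Rightarrow> 's \<Rightarrow> real) \<Rightarrow> bool"
  where "topical T \<longleftrightarrow> (\<forall>u w c. (\<forall>s. u s \<le> w s + c) \<longrightarrow> (\<forall>s. T u s \<le> T w s + c))"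

lemma topicalD: "topical T \<Longrightarrow> (\<And>s. u s \<le> w s + c) \<Longrightarrow> T u s \<le> T w s + c"
  unfolding topical_def by blast

lemma topical_add_const:
  assumes "topical T"
  shows "T (\<lambda>s. u s + c) s = T u s + c"
proof (rule antisym)
  show "T (\<lambda>s. u s + c) s \<le> T u s + c"
    by (rule topicalD[OF assms]) simp
  have "T u s \<le> T (\<lambda>s. u s + c) s + (- c)"
    by (rule topicalD[OF assms]) simp
  then show "T u s + c \<le> T (\<lambda>s. u s + c) s"
    by simp
qed

text \<open>Topical operators are nonexpansive for the maximum norm, hence continuous; the sum of
  the coordinate differences is used as a convenient upper bound of that norm.\<close>

lemma topical_tendsto:
  fixes T :: "('s::finite \<Rightarrow> real) \<Rightarrow> 's \<Rightarrow> real"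
  assumes T: "topical T" and lim: "\<And>s. ((\<lambda>x. f x s) \<longlongrightarrow> u s) F"
  shows "((\<lambda>x. T (f x) s) \<longlongrightarrow> T u s) F"
proof -
  have le: "T g s \<le> T h s + (\<Sum>t\<in>UNIV. \<bar>g t - h t\<bar>)" for g h
  proof (rule topicalD[OF T])
    fix s
    have "\<bar>g s - h s\<bar> \<le> (\<Sum>t\<in>UNIV. \<bar>g t - h t\<bar>)"
      by (rule member_le_sum) auto
    then show "g s \<le> h s + (\<Sum>t\<in>UNIV. \<bar>g t - h t\<bar>)"
      by linarith
  qed
  have bound: "\<bar>T (f x) s - T u s\<bar> \<le> (\<Sum>t\<in>UNIV. \<bar>f x t - u t\<bar>)" for x
    using le[of "f x" u] le[of u "f x"] by (simp add: abs_minus_commute)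
  have "((\<lambda>x. \<bar>f x t - u t\<bar>) \<longlongrightarrow> 0) F" for t
    using tendsto_diff[OF lim tendsto_const, of t "u t"] by (simp add: tendsto_rabs_zero)
  then have "((\<lambda>x. \<Sum>t\<in>UNIV. \<bar>f x t - u t\<bar>) \<longlongrightarrow> (\<Sum>t\<in>(UNIV::'s set). 0)) F"
    by (intro tendsto_sum)
  then have "((\<lambda>x. \<Sum>t\<in>UNIV. \<bar>f x t - u t\<bar>) \<longlongrightarrow> 0) F"
    by simp
  then have "((\<lambda>x. T (f x) s - T u s) \<longlongrightarrow> 0) F"
    by (rule Lim_null_comparison[rotated]) (simp add: bound)
  then show ?thesis
    by (simp add: LIM_zero_iff)
qed

text \<open>The box \<open>[0, 1 / (1 - l)]\<close> is mapped to itself since its upper end solves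
  \<open>b = 1 + l b\<close>, so Brouwer's theorem gives a fixed point that obeys these bounds.\<close>

lemma topical_discounted_fixed_point:
  fixes T :: "('s::finite \<Rightarrow> real) \<Rightarrow> 's \<Rightarrow> real"
  assumes T: "topical T" and T0: "\<And>s. T (\<lambda>_. 0) s \<in> {0..1}" and l: "0 \<le> l" "l < 1"
  obtains v where "\<And>s. v s \<in> {0..1 / (1 - l)}" "\<And>s. T (\<lambda>t. l * v t) s = v s"
proof -
  define b where "b = 1 / (1 - l)"
  have b: "b = 1 + l * b" "0 \<le> b"
    using l by (auto simp: b_def field_simps)
  define G :: "real ^ 's \<Rightarrow> real ^ 's" where "G x = (\<chi> s. T (\<lambda>t. l * x $ t) s)" for x
  let ?K = "cbox 0 (\<chi> s. b) :: (real ^ 's) set"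
  have "continuous_on ?K G"
    unfolding continuous_on_def G_def
    by (intro ballI vec_tendstoI) (auto intro!: topical_tendsto[OF T] tendsto_intros)
  moreover have "G \<in> ?K \<rightarrow> ?K"
  proof
    fix x assume x: "x \<in> ?K"
    have *: "T (\<lambda>_. 0) s \<le> T (\<lambda>t. l * x $ t) s + 0" for s
      using x l by (intro topicalD[OF T]) (simp add: mem_box_cart)
    have **: "T (\<lambda>t. l * x $ t) s \<le> T (\<lambda>_. 0) s + l * b" for s
      using x l by (intro topicalD[OF T]) (simp add: mem_box_cart mult_left_mono)
    have "0 \<le> T (\<lambda>t. l * x $ t) s \<and> T (\<lambda>t. l * x $ t) s \<le> b" for s
      using *[of s] **[of s] T0[of s] b by auto
    then show "G x \<in> ?K"
      by (simp add: mem_box_cart G_def)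
  qed
  moreover have "?K \<noteq> {}"
    using b by (simp add: interval_ne_empty_cart)
  ultimately obtain x where "x \<in> ?K" "G x = x"
    using brouwer[of ?K G] by (auto simp: convex_box)
  then have "x $ s \<in> {0..1 / (1 - l)}" "T (\<lambda>t. l * x $ t) s = x $ s" for s
    by (auto simp: mem_box_cart G_def b_def vec_eq_iff)
  then show thesis
    by (rule that)
qed

text \<open>Normalising \<open>v\<close> at a reference state turns \<open>T (l v) = v\<close> into
  \<open>T (l h) = h + a\<close> with \<open>h = v - v s\<^sub>0\<close> and \<open>a = (1 - l) v s\<^sub>0\<close>. Here \<open>h\<close> is bounded by
  the span and \<open>a\<close> lies in the unit interval, so both have limit points.\<close>

lemma topical_eigenvector_vanishing_discount:
  fixes T :: "('s::finite \<Rightarrow> real) \<Rightarrow> 's \<Rightarrow> real"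
  assumes T: "topical T"
    and l: "\<And>n. l n < 1" "l \<longlonglongrightarrow> 1"
    and v: "\<And>n s. v n s \<in> {0..1 / (1 - l n)}" "\<And>n s. T (\<lambda>t. l n * v n t) s = v n s"
    and span: "\<forall>\<^sub>F n in sequentially. \<forall>s t. v n s - v n t \<le> K"
  obtains u \<alpha> where "\<alpha> \<in> {0..1::real}" "\<And>s. T (\<lambda>t. u t - \<alpha>) s = u s"
proof -
  fix s0 :: 's
  from span obtain N where N: "\<And>n s t. n \<ge> N \<Longrightarrow> v n s - v n t \<le> K"
    unfolding eventually_sequentially by blast
  define h where "h n s = v (n + N) s - v (n + N) s0" for n s
  define a where "a n = (1 - l (n + N)) * v (n + N) s0" for n
  \<comment> \<open>The index \<open>None\<close> carries the approximate gain, so that one subsequence serves both.\<close>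
  define f where "f n = (\<lambda>i. case i of None \<Rightarrow> a n | Some s \<Rightarrow> h n s)" for n
  define B where "B = (\<lambda>i::'s option. case i of None \<Rightarrow> {0..1} | Some s \<Rightarrow> {- K..K})"
  have a: "a n \<in> {0..1}" for n
  proof -
    have "0 < 1 - l (n + N)" "0 \<le> v (n + N) s0" "v (n + N) s0 \<le> 1 / (1 - l (n + N))"
      using l(1)[of "n + N"] v(1)[of "n + N" s0] by auto
    then show ?thesis
      by (simp add: a_def pos_le_divide_eq mult.commute)
  qed
  have "h n s \<in> {- K..K}" for n s
    using N[of "n + N" s s0] N[of "n + N" s0 s] by (auto simp: h_def)
  with a have "f n i \<in> B i" for n i
    by (simp add: f_def B_def split: option.split)
  moreover have "compact (B i)" for i
    by (simp add: B_def split: option.split)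
  ultimately obtain y g where g: "strict_mono g"
    and y: "\<And>i. y i \<in> B i" "\<And>i. (\<lambda>n. f (g n) i) \<longlonglongrightarrow> y i"
    using finite_family_convergent_subseq[of B f] by metis
  define \<alpha> where "\<alpha> = y None"
  define u where "u s = y (Some s)" for s
  have lim_a: "(\<lambda>n. a (g n)) \<longlonglongrightarrow> \<alpha>"
    using y(2)[of None] by (simp add: f_def \<alpha>_def)
  have lim_h: "(\<lambda>n. h (g n) s) \<longlonglongrightarrow> u s" for s
    using y(2)[of "Some s"] by (simp add: f_def u_def)
  have lim_l: "(\<lambda>n. l (g n + N)) \<longlonglongrightarrow> 1"
    using LIMSEQ_subseq_LIMSEQ[OF LIMSEQ_ignore_initial_segment[OF l(2), of N] g]
    by (simp add: o_def)
  have eq: "T (\<lambda>t. l (n + N) * h n t) s = h n s + a n" for n s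
  proof -
    have "(\<lambda>t. l (n + N) * v (n + N) t) =
        (\<lambda>t. l (n + N) * h n t + l (n + N) * v (n + N) s0)"
      by (simp add: h_def algebra_simps)
    then have "v (n + N) s = T (\<lambda>t. l (n + N) * h n t) s + l (n + N) * v (n + N) s0"
      using v(2)[of "n + N" s] by (simp add: topical_add_const[OF T])
    then show ?thesis
      by (simp add: h_def a_def algebra_simps)
  qed
  have "(\<lambda>n. T (\<lambda>t. l (g n + N) * h (g n) t) s) \<longlonglongrightarrow> T (\<lambda>t. 1 * u t) s" for s
    by (intro topical_tendsto[OF T] tendsto_mult lim_l lim_h)
  then have "(\<lambda>n. h (g n) s + a (g n)) \<longlonglongrightarrow> T u s" for s
    by (simp add: eq)
  moreover have "(\<lambda>n. h (g n) s + a (g n)) \<longlonglongrightarrow> u s + \<alpha>" for s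
    by (intro tendsto_add lim_a lim_h)
  ultimately have "T u s = u s + \<alpha>" for s
    using LIMSEQ_unique by blast
  then have "T (\<lambda>t. u t - \<alpha>) s = u s" for s
    using topical_add_const[OF T, of u "- \<alpha>" s] by simp
  moreover have "\<alpha> \<in> {0..1}"
    using y(1)[of None] by (simp add: \<alpha>_def B_def)
  ultimately show thesis
    using that by blast
qed

section \<open>Finite Markov chains\<close>

definition stochastic :: "real ^ 's::finite ^ 's \<Rightarrow> bool"
  where "stochastic M \<longleftrightarrow> (\<forall>x. M $ x \<in> prob_simplex)"

lemma stochastic_nonneg: "stochastic M \<Longrightarrow> 0 \<le> M $ x $ y"
  by (simp add: stochastic_def prob_simplex_def)

lemma stochastic_sum: "stochastic M \<Longrightarrow> (\<Sum>y\<in>UNIV. M $ x $ y) = 1"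
  by (simp add: stochastic_def prob_simplex_def)

lemma mat_power_0: "mat_power M 0 = mat 1"
  by (simp add: mat_power_def)

lemma mat_power_Suc: "mat_power M (Suc k) $ x $ y = (\<Sum>z\<in>UNIV. M $ x $ z * mat_power M k $ z $ y)"
  by (simp add: mat_power_def matrix_matrix_mult_def)

lemma mat_power_sum_Suc:
  "(\<Sum>y\<in>UNIV. mat_power M (Suc k) $ x $ y * v y) =
   (\<Sum>z\<in>UNIV. M $ x $ z * (\<Sum>y\<in>UNIV. mat_power M k $ z $ y * v y))"
  unfolding mat_power_Suc sum_distrib_right sum_distrib_left
  by (subst sum.swap) (simp add: mult.assoc)

lemma mat_power_sum_0: "(\<Sum>y\<in>UNIV. mat_power M 0 $ x $ y * v y) = v x"
  by (simp add: mat_power_0 mat_def if_distrib[of "\<lambda>a. a * _"] cong: if_cong)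

lemma stochastic_mat_power:
  assumes "stochastic M"
  shows "stochastic (mat_power M k)"
proof -
  have nonneg: "0 \<le> mat_power M k $ x $ y" for x y
    by (induction k arbitrary: x)
      (auto simp: mat_power_0 mat_power_Suc mat_def intro!: sum_nonneg mult_nonneg_nonneg
        stochastic_nonneg[OF assms])
  have "(\<Sum>y\<in>UNIV. mat_power M k $ x $ y * 1) = 1" for x
  proof (induction k arbitrary: x)
    case (Suc k)
    then show ?case
      by (simp only: mat_power_sum_Suc) (simp add: stochastic_sum[OF assms])
  next
    case 0
    show ?case
      by (simp only: mat_power_sum_0)
  qed
  with nonneg show ?thesis
    by (simp add: stochastic_def prob_simplex_def)
qed

lemma tendsto_mat_power:
  fixes M :: "real ^ 's::finite ^ 's"
  assumes "\<And>x y. ((\<lambda>n. W n $ x $ y) \<longlongrightarrow> M $ x $ y) F"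
  shows "((\<lambda>n. mat_power (W n) k $ x $ y) \<longlongrightarrow> mat_power M k $ x $ y) F"
  by (induction k arbitrary: x)
    (auto simp: mat_power_0 mat_power_Suc intro!: tendsto_sum tendsto_mult assms)

lemma subharmonic_mat_power:
  assumes M: "stochastic M" and v: "\<And>x. v x \<le> c + (\<Sum>y\<in>UNIV. M $ x $ y * v y)"
  shows "v x \<le> real k * c + (\<Sum>y\<in>UNIV. mat_power M k $ x $ y * v y)"
proof (induction k arbitrary: x)
  case 0
  show ?case
    by (simp only: mat_power_sum_0)
next
  case (Suc k)
  have "v x \<le> c + (\<Sum>z\<in>UNIV. M $ x $ z * v z)"
    by (rule v)
  also have "\<dots> \<le> c + (\<Sum>z\<in>UNIV. M $ x $ z * (real k * c + (\<Sum>y\<in>UNIV. mat_power M k $ z $ y * v y)))"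
    by (intro add_left_mono sum_mono mult_left_mono Suc stochastic_nonneg[OF M])
  also have "\<dots> = c + real k * c + (\<Sum>y\<in>UNIV. mat_power M (Suc k) $ x $ y * v y)"
    by (simp add: mat_power_sum_Suc distrib_left sum.distrib stochastic_sum[OF M]
        flip: sum_distrib_right)
  finally show ?case
    by (simp add: algebra_simps)
qed

text \<open>If \<open>x\<close> leads to \<open>y\<close> with probability more than \<open>d\<close> in \<open>k\<close> steps, then
  iterating \<open>v \<le> c + W v\<close> shows that the deficit \<open>m - v\<close> at \<open>x\<close> is at least
  \<open>d\<close> times the deficit at \<open>y\<close>, up to \<open>k c\<close>. The chains vary with \<open>n\<close>, and their limit
  provides one \<open>d\<close> for all late \<open>n\<close>. Applied to \<open>- v\<close>, the lemma
  compares values with the minimum.\<close>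

lemma bounded_deficit_propagates:
  fixes M :: "real ^ 's::finite ^ 's"
  assumes W: "\<And>n. stochastic (W n)"
    and lim: "\<And>x y. (\<lambda>n. W n $ x $ y) \<longlonglongrightarrow> M $ x $ y"
    and v: "\<And>n x. v n x \<le> c + (\<Sum>y\<in>UNIV. W n $ x $ y * v n y)"
    and m: "\<And>n x. v n x \<le> m n"
    and pos: "mat_power M k $ x $ y > 0"
    and x: "\<forall>\<^sub>F n in sequentially. m n - v n x \<le> B"
  obtains B' where "\<forall>\<^sub>F n in sequentially. m n - v n y \<le> B'"
proof -
  define d where "d = mat_power M k $ x $ y / 2"
  have d: "0 < d" "d < mat_power M k $ x $ y"
    using pos by (auto simp: d_def)
  have "\<forall>\<^sub>F n in sequentially. d < mat_power (W n) k $ x $ y"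
    using order_tendstoD(1)[OF tendsto_mat_power[of W M, OF lim] d(2)] .
  with x have "\<forall>\<^sub>F n in sequentially. m n - v n y \<le> (B + real k * c) / d"
  proof eventually_elim
    case (elim n)
    let ?p = "\<lambda>z. mat_power (W n) k $ x $ z"
    note st = stochastic_mat_power[OF W[of n], of k]
    have "d * (m n - v n y) \<le> ?p y * (m n - v n y)"
      using elim(2) m[of n y] by (intro mult_right_mono) auto
    also have "\<dots> \<le> (\<Sum>z\<in>UNIV. ?p z * (m n - v n z))"
      using m by (intro member_le_sum) (auto intro!: mult_nonneg_nonneg stochastic_nonneg[OF st])
    also have "\<dots> = m n - (\<Sum>z\<in>UNIV. ?p z * v n z)"
      by (simp add: right_diff_distrib sum_subtractf stochastic_sum[OF st]
          flip: sum_distrib_right)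
    also have "\<dots> \<le> m n - (v n x - real k * c)"
      using subharmonic_mat_power[OF W v, of n x k] by simp
    also have "\<dots> \<le> B + real k * c"
      using elim(1) by simp
    finally show ?case
      using d(1) by (simp add: field_simps)
  qed
  then show thesis
    by (rule that)
qed

text \<open>Nonemptiness is part of the notion, so that minimal closed sets are the recurrent
  classes of the chain.\<close>

definition closed_states :: "real ^ 's::finite ^ 's \<Rightarrow> 's set \<Rightarrow> bool"
  where "closed_states M R \<longleftrightarrow> R \<noteq> {} \<and> (\<forall>x\<in>R. \<forall>y. M $ x $ y > 0 \<longrightarrow> y \<in> R)"

lemma hitting_probability_first_step:
  fixes M :: "real ^ 's::finite ^ 's"
  assumes "stochastic M"
  shows "(\<Sum>n. first_passage M n x y) =
    M $ x $ y + (\<Sum>z\<in>UNIV - {y}. M $ x $ z * (\<Sum>n. first_passage M n z y))"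
proof -
  have sm: "summable (\<lambda>n. first_passage M n z y)" for z
    using assms by (intro summable_first_passage) (simp add: stochastic_def)
  have "(\<Sum>n. first_passage M n x y) = (\<Sum>n. first_passage M (Suc n) x y)"
    using suminf_split_head[OF sm] by simp
  also have "\<dots> = first_passage M (Suc 0) x y + (\<Sum>n. first_passage M (Suc (Suc n)) x y)"
    using suminf_split_head[of "\<lambda>n. first_passage M (Suc n) x y"] sm[of x]
      summable_Suc_iff[of "\<lambda>n. first_passage M n x y"]
    by linarith
  also have "(\<Sum>n. first_passage M (Suc (Suc n)) x y) =
      (\<Sum>z\<in>UNIV - {y}. M $ x $ z * (\<Sum>n. first_passage M (Suc n) z y))"
  proof -
    have sm': "summable (\<lambda>n. first_passage M (Suc n) z y)" for z
      using sm[of z] by (subst summable_Suc_iff)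
    then show ?thesis
      by (simp add: suminf_sum suminf_mult summable_mult)
  qed
  also have "\<dots> = (\<Sum>z\<in>UNIV - {y}. M $ x $ z * (\<Sum>n. first_passage M n z y))"
    using suminf_split_head[OF sm] by simp
  finally show ?thesis
    by simp
qed

text \<open>In a minimal closed set, fix a target \<open>y\<close> and consider the probability \<open>h x\<close> of ever
  visiting \<open>y\<close> from \<open>x\<close> at a positive time. If \<open>h\<close> took a value below 1, its minimisers would form a closed
  set that the chain never leaves for \<open>y\<close>. By minimality they are all the states, and then
  removing \<open>y\<close> leaves a smaller closed set.\<close>

lemma closed_states_not_all_transient:
  fixes M :: "real ^ 's::finite ^ 's"
  assumes M: "stochastic M" and R: "closed_states M R"
  obtains y where "y \<in> R" "\<not> transient M y"
proof -
  obtain R' where R': "closed_states M R'" "R' \<subseteq> R"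
    and minimal: "\<And>R''. closed_states M R'' \<Longrightarrow> R'' \<subseteq> R' \<Longrightarrow> R'' = R'"
  proof -
    let ?A = "{R'. closed_states M R' \<and> R' \<subseteq> R}"
    have "finite ?A" "?A \<noteq> {}"
      using R by auto
    from finite_has_minimal[OF this] obtain R' where R': "R' \<in> ?A"
      and min: "\<forall>R''\<in>?A. R'' \<subseteq> R' \<longrightarrow> R' = R''"
      by auto
    show thesis
    proof (rule that[of R'])
      fix R'' assume "closed_states M R''" "R'' \<subseteq> R'"
      with R' min show "R'' = R'"
        by (metis (mono_tags, lifting) mem_Collect_eq order_trans)
    qed (use R' in auto)
  qed
  from R'(1) obtain y where y: "y \<in> R'"
    by (auto simp: closed_states_def)
  define h where "h x = (\<Sum>n. first_passage M n x y)" for x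
  define m where "m = Min (h ` R')"
  have "\<not> h y < 1"
  proof
    assume "h y < 1"
    have m_le: "m \<le> h x" if "x \<in> R'" for x
      using that by (simp add: m_def)
    have m1: "m < 1"
      using m_le[OF y] \<open>h y < 1\<close> by simp
    have "m \<in> h ` R'"
      using y unfolding m_def by (intro Min_in) auto
    \<comment> \<open>A minimiser of \<open>h\<close> averages the values of \<open>h\<close>, with the value 1 at \<open>y\<close>;
      as the minimum is below 1, the chain can move from it only to minimisers, and not to \<open>y\<close>.\<close>
    have step: "M $ x $ y = 0 \<and> (M $ x $ z > 0 \<longrightarrow> h z = m)" if x: "x \<in> R'" "h x = m" for x z
    proof -
      define H where "H z = (if z = y then 1 else h z)" for z
      have terms: "0 \<le> M $ x $ w * (H w - m)" for w
      proof (cases "M $ x $ w > 0")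
        case True
        then have "w \<in> R'"
          using R'(1) x by (auto simp: closed_states_def)
        then show ?thesis
          using m1 m_le True by (auto simp: H_def)
      next
        case False
        then show ?thesis
          using stochastic_nonneg[OF M, of x w] by simp
      qed
      have "h x = M $ x $ y * H y + (\<Sum>w\<in>UNIV - {y}. M $ x $ w * H w)"
        using hitting_probability_first_step[OF M, of x y] by (simp add: H_def flip: h_def)
      also have "\<dots> = (\<Sum>w\<in>UNIV. M $ x $ w * H w)"
        by (rule sum.remove[symmetric]) auto
      finally have "(\<Sum>w\<in>UNIV. M $ x $ w * (H w - m)) = 0"
        by (simp add: right_diff_distrib sum_subtractf stochastic_sum[OF M] x
            flip: sum_distrib_right)
      then have zero: "M $ x $ w * (H w - m) = 0" for w
        using terms by (simp add: sum_nonneg_eq_0_iff)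
      have "M $ x $ y = 0"
        using zero[of y] m1 by (simp add: H_def)
      with zero[of z] show ?thesis
        by (auto simp: H_def)
    qed
    have "closed_states M {x\<in>R'. h x = m}"
      unfolding closed_states_def
    proof (intro conjI ballI allI impI)
      show "{x \<in> R'. h x = m} \<noteq> {}"
        using \<open>m \<in> h ` R'\<close> by auto
    next
      fix x z assume x: "x \<in> {x \<in> R'. h x = m}" and xz: "M $ x $ z > 0"
      then have "z \<in> R'"
        using R'(1) by (auto simp: closed_states_def)
      moreover have "h z = m"
        using step[of x z] x xz by simp
      ultimately show "z \<in> {x \<in> R'. h x = m}"
        by simp
    qed
    then have all: "h x = m" if "x \<in> R'" for x
      using minimal that by blast
    have "\<exists>z. M $ y $ z > 0"
    proof (rule ccontr)
      assume "\<nexists>z. M $ y $ z > 0"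
      then have "(\<Sum>z\<in>UNIV. M $ y $ z) \<le> 0"
        by (intro sum_nonpos) (simp add: not_less)
      then show False
        by (simp add: stochastic_sum[OF M])
    qed
    then obtain z where z: "M $ y $ z > 0" ..
    have "z \<in> R'" "z \<noteq> y"
      using z R'(1) y step[OF y all[OF y], of z] by (auto simp: closed_states_def)
    have "closed_states M (R' - {y})"
      unfolding closed_states_def
    proof (intro conjI ballI allI impI)
      show "R' - {y} \<noteq> {}"
        using \<open>z \<in> R'\<close> \<open>z \<noteq> y\<close> by blast
    next
      fix x w assume x: "x \<in> R' - {y}" and xw: "M $ x $ w > 0"
      then have "w \<in> R'"
        using R'(1) by (auto simp: closed_states_def)
      moreover have "w \<noteq> y"
        using step[of x w] all[of x] x xw by auto
      ultimately show "w \<in> R' - {y}"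
        by simp
    qed
    then show False
      using minimal[of "R' - {y}"] y by blast
  qed
  then have "\<not> transient M y"
    by (simp add: transient_def h_def)
  then show thesis
    using that y R'(2) by blast
qed

text \<open>The states that do not lead to \<open>C\<close> would form a closed set of transient states.\<close>

lemma reaches_complement_of_transient:
  fixes M :: "real ^ 's::finite ^ 's"
  assumes M: "stochastic M" and C: "\<And>y. y \<notin> C \<Longrightarrow> transient M y"
  obtains c k where "c \<in> C" "mat_power M k $ x $ c > 0"
proof -
  define D where "D = {x. \<forall>c\<in>C. \<forall>k. \<not> mat_power M k $ x $ c > 0}"
  have "x \<notin> D"
  proof
    assume "x \<in> D"
    moreover have "z \<in> D" if x: "x \<in> D" and xz: "M $ x $ z > 0" for x z
    proof (rule ccontr)
      assume "z \<notin> D"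
      then obtain c k where c: "c \<in> C" "mat_power M k $ z $ c > 0"
        by (auto simp: D_def)
      have "0 < M $ x $ z * mat_power M k $ z $ c"
        using xz c by simp
      also have "\<dots> \<le> mat_power M (Suc k) $ x $ c"
        unfolding mat_power_Suc
        by (rule member_le_sum)
          (auto intro!: mult_nonneg_nonneg stochastic_nonneg M stochastic_mat_power)
      finally show False
        using x c unfolding D_def by blast
    qed
    ultimately have "closed_states M D"
      unfolding closed_states_def by blast
    then obtain y where y: "y \<in> D" "\<not> transient M y"
      using closed_states_not_all_transient[OF M] by blast
    have "mat_power M 0 $ y $ y > 0"
      by (simp add: mat_power_0 mat_def)
    then have "y \<notin> C"
      using y(1) unfolding D_def by blast
    with C y show False
      by blast
  qed
  then show thesis
    using that by (auto simp: D_def)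
qed

section \<open>The robust Bellman operator\<close>

definition payoff ::
    "('s \<Rightarrow> 'a \<Rightarrow> real) \<Rightarrow> ('s \<Rightarrow> real) \<Rightarrow> 's \<Rightarrow> real ^ 'a::finite \<Rightarrow> real ^ 's::finite ^ 'a \<Rightarrow> real"
  where "payoff r u s \<phi> q = (\<Sum>a\<in>UNIV. \<Sum>s'\<in>UNIV. \<phi> $ a * q $ a $ s' * (r s a + u s'))"

definition bellman ::
    "('s \<Rightarrow> 'a \<Rightarrow> real) \<Rightarrow> (real ^ 'a::finite) set \<Rightarrow> ('s \<Rightarrow> (real ^ 's::finite ^ 'a) set) \<Rightarrow>
     ('s \<Rightarrow> real) \<Rightarrow> 's \<Rightarrow> real"
  where "bellman r Q P u s = (SUP \<phi>\<in>Q. INF q\<in>P s. payoff r u s \<phi> q)"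

lemma transition_kernels_sum: "q \<in> transition_kernels \<Longrightarrow> (\<Sum>s'\<in>UNIV. q $ a $ s') = 1"
  by (simp add: transition_kernels_def prob_simplex_def)

lemma stochastic_induced_chain:
  assumes "\<And>s. p s \<in> transition_kernels" "\<And>s. \<Delta> s \<in> prob_simplex"
  shows "stochastic (induced_chain p \<Delta>)"
proof -
  have "(\<Sum>s'\<in>UNIV. \<Sum>a\<in>UNIV. p s $ a $ s' * \<Delta> s $ a) = 1" for s
    using assms(2)[of s]
    by (subst sum.swap) (simp add: transition_kernels_sum assms(1) prob_simplex_def
        flip: sum_distrib_right)
  moreover have "0 \<le> (\<Sum>a\<in>UNIV. p s $ a $ s' * \<Delta> s $ a)" for s s'
    using assms by (auto intro!: sum_nonneg mult_nonneg_nonneg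
        simp: transition_kernels_def prob_simplex_def)
  ultimately show ?thesis
    by (simp add: stochastic_def prob_simplex_def induced_chain_def)
qed

text \<open>Separating the reward from the continuation value makes the Markov chain of the two
  policies appear; this is how the statements on stochastic matrices apply to payoffs.\<close>

lemma payoff_induced_chain:
  assumes "p s \<in> transition_kernels"
  shows "payoff r u s (\<Delta> s) (p s) =
    (\<Sum>a\<in>UNIV. \<Delta> s $ a * r s a) + (\<Sum>s'\<in>UNIV. induced_chain p \<Delta> $ s $ s' * u s')"
proof -
  have "payoff r u s (\<Delta> s) (p s) =
      (\<Sum>a\<in>UNIV. \<Delta> s $ a * r s a * (\<Sum>s'\<in>UNIV. p s $ a $ s')) +
      (\<Sum>a\<in>UNIV. \<Sum>s'\<in>UNIV. p s $ a $ s' * \<Delta> s $ a * u s')"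
    unfolding payoff_def sum_distrib_left sum.distrib[symmetric]
    by (simp add: algebra_simps)
  also have "(\<Sum>a\<in>UNIV. \<Sum>s'\<in>UNIV. p s $ a $ s' * \<Delta> s $ a * u s') =
      (\<Sum>s'\<in>UNIV. induced_chain p \<Delta> $ s $ s' * u s')"
    by (subst sum.swap) (simp add: induced_chain_def sum_distrib_right)
  finally show ?thesis
    by (simp add: transition_kernels_sum[OF assms])
qed

lemma expected_reward_bounds:
  assumes "\<And>a. r s a \<in> {0..1::real}" "\<phi> \<in> prob_simplex"
  shows "(\<Sum>a\<in>UNIV. \<phi> $ a * r s a) \<in> {0..1}"
proof -
  have "(\<Sum>a\<in>UNIV. \<phi> $ a * r s a) \<le> (\<Sum>a\<in>UNIV. \<phi> $ a * 1)"
    using assms by (intro sum_mono mult_left_mono) (auto simp: prob_simplex_def)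
  moreover have "0 \<le> (\<Sum>a\<in>UNIV. \<phi> $ a * r s a)"
    using assms by (intro sum_nonneg mult_nonneg_nonneg) (auto simp: prob_simplex_def)
  ultimately show ?thesis
    using assms by (simp add: prob_simplex_def)
qed

lemma payoff_le_shift:
  fixes q :: "real ^ 's::finite ^ 'a::finite"
  assumes \<phi>: "\<phi> \<in> prob_simplex" and q: "q \<in> transition_kernels" and le: "\<And>s. u s \<le> w s + c"
  shows "payoff r u s \<phi> q \<le> payoff r w s \<phi> q + c"
proof -
  \<comment> \<open>The pair \<open>\<phi>\<close>, \<open>q\<close> is read as a pair of policies that use it in every state.\<close>
  let ?M = "induced_chain (\<lambda>_::'s. q) (\<lambda>_. \<phi>)"
  have M: "stochastic ?M"
    using \<phi> q by (intro stochastic_induced_chain) auto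
  have "(\<Sum>s'\<in>UNIV. ?M $ s $ s' * u s') \<le> (\<Sum>s'\<in>UNIV. ?M $ s $ s' * (w s' + c))"
    by (intro sum_mono mult_left_mono le stochastic_nonneg[OF M])
  also have "\<dots> = (\<Sum>s'\<in>UNIV. ?M $ s $ s' * w s') + c"
    by (simp add: distrib_left sum.distrib stochastic_sum[OF M] flip: sum_distrib_right)
  finally show ?thesis
    using payoff_induced_chain[of "\<lambda>_. q" s r _ "\<lambda>_. \<phi>"] q by simp
qed

lemma payoff_bounds:
  assumes r: "\<And>s a. r s a \<in> {0..1}" and \<phi>: "\<phi> \<in> prob_simplex" and q: "q \<in> transition_kernels"
    and u: "\<And>s. \<bar>u s\<bar> \<le> B"
  shows "- B \<le> payoff r u s \<phi> q" "payoff r u s \<phi> q \<le> 1 + B"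
proof -
  have "payoff r (\<lambda>_. 0) s \<phi> q \<in> {0..1}"
    using payoff_induced_chain[of "\<lambda>_. q" s r "\<lambda>_. 0" "\<lambda>_. \<phi>"] q
      expected_reward_bounds[of r s \<phi>] r \<phi> by simp
  moreover have "payoff r (\<lambda>_. 0) s \<phi> q \<le> payoff r u s \<phi> q + B"
    using u by (intro payoff_le_shift \<phi> q) (smt (verit))
  moreover have "payoff r u s \<phi> q \<le> payoff r (\<lambda>_. 0) s \<phi> q + B"
    using u by (intro payoff_le_shift \<phi> q) (smt (verit))
  ultimately show "- B \<le> payoff r u s \<phi> q" "payoff r u s \<phi> q \<le> 1 + B"
    by auto
qed

lemma bdd_payoff:
  fixes r :: "'s::finite \<Rightarrow> 'a::finite \<Rightarrow> real" and P :: "'s \<Rightarrow> (real ^ 's ^ 'a) set"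
  assumes r: "\<And>s a. r s a \<in> {0..1}" and Q: "Q \<subseteq> prob_simplex"
    and P: "P s \<noteq> {}" "P s \<subseteq> transition_kernels"
  shows "\<phi> \<in> Q \<Longrightarrow> bdd_below (payoff r u s \<phi> ` P s)"
    and "bdd_above ((\<lambda>\<phi>. INF q\<in>P s. payoff r u s \<phi> q) ` Q)"
proof -
  define B where "B = (\<Sum>t\<in>UNIV. \<bar>u t\<bar>)"
  have u: "\<bar>u t\<bar> \<le> B" for t
    unfolding B_def by (rule member_le_sum) auto
  have bd: "- B \<le> payoff r u s \<phi> q" "payoff r u s \<phi> q \<le> 1 + B" if "\<phi> \<in> Q" "q \<in> P s" for \<phi> q
    using payoff_bounds[of r \<phi> q u B s, OF r _ _ u] that Q P by auto
  show bb: "bdd_below (payoff r u s \<phi> ` P s)" if "\<phi> \<in> Q" for \<phi>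
    using bd that by (intro bdd_belowI2[of _ "- B"]) auto
  obtain q where q: "q \<in> P s"
    using P by blast
  show "bdd_above ((\<lambda>\<phi>. INF q\<in>P s. payoff r u s \<phi> q) ` Q)"
    using order_trans[OF cINF_lower[OF bb q] bd(2)[OF _ q]]
    by (intro bdd_aboveI2[of _ _ "1 + B"]) blast
qed

lemma topical_bellman:
  fixes r :: "'s::finite \<Rightarrow> 'a::finite \<Rightarrow> real" and P :: "'s \<Rightarrow> (real ^ 's ^ 'a) set"
  assumes r: "\<And>s a. r s a \<in> {0..1}" and Q: "Q \<noteq> {}" "Q \<subseteq> prob_simplex"
    and P: "\<And>s. P s \<noteq> {}" "\<And>s. P s \<subseteq> transition_kernels"
  shows "topical (bellman r Q P)"
  unfolding topical_def
proof (intro allI impI)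
  fix u w :: "'s \<Rightarrow> real" and c s
  assume le: "\<forall>s. u s \<le> w s + c"
  note bdd = bdd_payoff[where r = r and Q = Q and P = P, OF r Q(2) P]
  show "bellman r Q P u s \<le> bellman r Q P w s + c"
    unfolding bellman_def
  proof (rule cSUP_least[OF Q(1)])
    fix \<phi> assume \<phi>: "\<phi> \<in> Q"
    have "(INF q\<in>P s. payoff r u s \<phi> q) - c \<le> (INF q\<in>P s. payoff r w s \<phi> q)"
    proof (rule cINF_greatest[OF P(1)])
      fix q assume q: "q \<in> P s"
      have "(INF q\<in>P s. payoff r u s \<phi> q) \<le> payoff r u s \<phi> q"
        by (rule cINF_lower[OF bdd(1)[OF \<phi>] q])
      also have "\<dots> \<le> payoff r w s \<phi> q + c"
        using le \<phi> q P Q by (intro payoff_le_shift) auto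
      finally show "(INF q\<in>P s. payoff r u s \<phi> q) - c \<le> payoff r w s \<phi> q"
        by simp
    qed
    also have "\<dots> \<le> (SUP \<phi>\<in>Q. INF q\<in>P s. payoff r w s \<phi> q)"
      by (rule cSUP_upper[OF \<phi> bdd(2)])
    finally show "(INF q\<in>P s. payoff r u s \<phi> q) \<le> (SUP \<phi>\<in>Q. INF q\<in>P s. payoff r w s \<phi> q) + c"
      by simp
  qed
qed

lemma bellman_zero_bounds:
  fixes r :: "'s::finite \<Rightarrow> 'a::finite \<Rightarrow> real" and P :: "'s \<Rightarrow> (real ^ 's ^ 'a) set"
  assumes r: "\<And>s a. r s a \<in> {0..1}" and Q: "Q \<noteq> {}" "Q \<subseteq> prob_simplex"
    and P: "\<And>s. P s \<noteq> {}" "\<And>s. P s \<subseteq> transition_kernels"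
  shows "bellman r Q P (\<lambda>_. 0) s \<in> {0..1}"
proof -
  note bdd = bdd_payoff[where r = r and Q = Q and P = P, OF r Q(2) P]
  have bd: "0 \<le> payoff r (\<lambda>_. 0) s \<phi> q" "payoff r (\<lambda>_. 0) s \<phi> q \<le> 1"
    if "\<phi> \<in> Q" "q \<in> P s" for \<phi> q
    using payoff_bounds[of r \<phi> q "\<lambda>_. 0" 0 s, OF r] that Q P by auto
  obtain \<phi> q where \<phi>: "\<phi> \<in> Q" and q: "q \<in> P s"
    using Q P by blast
  have "0 \<le> (INF q\<in>P s. payoff r (\<lambda>_. 0) s \<phi> q)"
    using bd \<phi> by (intro cINF_greatest[OF P(1)]) auto
  also have "\<dots> \<le> bellman r Q P (\<lambda>_. 0) s"
    unfolding bellman_def by (rule cSUP_upper[OF \<phi> bdd(2)])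
  finally have "0 \<le> bellman r Q P (\<lambda>_. 0) s" .
  moreover have "bellman r Q P (\<lambda>_. 0) s \<le> 1"
    unfolding bellman_def
    using order_trans[OF cINF_lower[OF bdd(1) q] bd(2)[OF _ q]]
    by (intro cSUP_least[OF Q(1)]) blast
  ultimately show ?thesis
    by simp
qed

text \<open>Policies within 1 of the supremum and the infimum suffice, so neither has to be attained.
  The constant 2 in the upper bound is this error plus one reward. In the lower bound it is the
  error plus the cost of dropping the discount, which is at most 1 because
  \<open>(1 - l) v \<le> 1\<close>.\<close>

lemma near_optimal_policies:
  fixes r :: "'s::finite \<Rightarrow> 'a::finite \<Rightarrow> real" and P :: "'s \<Rightarrow> (real ^ 's ^ 'a) set"
  assumes r: "\<And>s a. r s a \<in> {0..1}" and Q: "Q \<noteq> {}" "Q \<subseteq> prob_simplex"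
    and P: "\<And>s. P s \<noteq> {}" "\<And>s. P s \<subseteq> transition_kernels"
    and l: "0 \<le> l" "l < 1"
    and v: "\<And>s. v s \<in> {0..1 / (1 - l)}" "\<And>s. bellman r Q P (\<lambda>t. l * v t) s = v s"
  obtains \<Delta> p where "\<And>s. \<Delta> s \<in> Q" "\<And>s. p s \<in> P s"
    "\<And>p' s. p' \<in> Pi UNIV P \<Longrightarrow> v s \<le> 2 + (\<Sum>y\<in>UNIV. induced_chain p' \<Delta> $ s $ y * v y)"
    "\<And>s. (\<Sum>y\<in>UNIV. induced_chain p \<Delta> $ s $ y * v y) \<le> v s + 2"
proof -
  note bdd = bdd_payoff[where r = r and Q = Q and P = P, OF r Q(2) P]
  let ?pay = "payoff r (\<lambda>t. l * v t)"
  have "\<exists>\<phi>\<in>Q. v s - 1 < (INF q\<in>P s. ?pay s \<phi> q)" for s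
    using v(2)[of s] less_cSUP_iff[OF Q(1) bdd(2)[where u = "\<lambda>t. l * v t"], of "v s - 1" s]
    unfolding bellman_def by simp
  then obtain \<Delta> where \<Delta>: "\<And>s. \<Delta> s \<in> Q" "\<And>s. v s - 1 < (INF q\<in>P s. ?pay s (\<Delta> s) q)"
    by metis
  have "\<exists>q\<in>P s. ?pay s (\<Delta> s) q < v s + 1" for s
  proof -
    have "(INF q\<in>P s. ?pay s (\<Delta> s) q) \<le> v s"
      using cSUP_upper[OF \<Delta>(1) bdd(2)[where u = "\<lambda>t. l * v t"], of s s] v(2)[of s]
      unfolding bellman_def by simp
    then show ?thesis
      using cINF_less_iff[OF P(1) bdd(1)[OF \<Delta>(1), where u = "\<lambda>t. l * v t"], of s s "v s + 1"]
      by simp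
  qed
  then obtain p where p: "\<And>s. p s \<in> P s" "\<And>s. ?pay s (\<Delta> s) (p s) < v s + 1"
    by metis
  have M: "stochastic (induced_chain p' \<Delta>)" if "p' \<in> Pi UNIV P" for p'
    using that P \<Delta>(1) Q(2) by (intro stochastic_induced_chain) blast+
  have pay: "?pay s (\<Delta> s) (p' s) = (\<Sum>a\<in>UNIV. \<Delta> s $ a * r s a) +
      (\<Sum>y\<in>UNIV. induced_chain p' \<Delta> $ s $ y * (l * v y))" if "p' \<in> Pi UNIV P" for p' s
    using that P by (intro payoff_induced_chain) blast
  have rew: "(\<Sum>a\<in>UNIV. \<Delta> s $ a * r s a) \<in> {0..1}" for s
    using expected_reward_bounds[of r s "\<Delta> s"] r \<Delta>(1)[of s] Q(2) by blast
  have lv: "l * v y \<le> v y" "v y - 1 \<le> l * v y" for y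
    using v(1)[of y] l by (auto simp: field_simps mult_left_le_one_le)
  have "v s \<le> 2 + (\<Sum>y\<in>UNIV. induced_chain p' \<Delta> $ s $ y * v y)" if p': "p' \<in> Pi UNIV P" for p' s
  proof -
    have "(INF q\<in>P s. ?pay s (\<Delta> s) q) \<le> ?pay s (\<Delta> s) (p' s)"
      using p' by (intro cINF_lower[OF bdd(1)[OF \<Delta>(1)]]) blast
    moreover have "(\<Sum>y\<in>UNIV. induced_chain p' \<Delta> $ s $ y * (l * v y)) \<le>
        (\<Sum>y\<in>UNIV. induced_chain p' \<Delta> $ s $ y * v y)"
      by (intro sum_mono mult_left_mono lv stochastic_nonneg[OF M[OF p']])
    ultimately show ?thesis
      using \<Delta>(2)[of s] pay[OF p', of s] rew[of s] by simp
  qed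
  moreover have "(\<Sum>y\<in>UNIV. induced_chain p \<Delta> $ s $ y * v y) \<le> v s + 2" for s
  proof -
    have pP: "p \<in> Pi UNIV P"
      using p by blast
    have "(\<Sum>y\<in>UNIV. induced_chain p \<Delta> $ s $ y * v y) - 1 =
        (\<Sum>y\<in>UNIV. induced_chain p \<Delta> $ s $ y * (v y - 1))"
      by (simp add: right_diff_distrib sum_subtractf stochastic_sum[OF M[OF pP]])
    also have "\<dots> \<le> (\<Sum>y\<in>UNIV. induced_chain p \<Delta> $ s $ y * (l * v y))"
      by (intro sum_mono mult_left_mono lv stochastic_nonneg[OF M[OF pP]])
    finally show ?thesis
      using p(2)[of s] pay[OF pP, of s] rew[of s] by simp
  qed
  ultimately show thesis
    using that \<Delta>(1) p(1) by blast
qed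

lemma tendsto_induced_chain:
  fixes p :: "'s::finite \<Rightarrow> real ^ 's ^ 'a::finite"
  assumes "\<And>s. ((\<lambda>n. p' n s) \<longlongrightarrow> p s) F" "\<And>s. ((\<lambda>n. D n s) \<longlongrightarrow> \<Delta> s) F"
  shows "((\<lambda>n. induced_chain (p' n) (D n) $ x $ y) \<longlongrightarrow> induced_chain p \<Delta> $ x $ y) F"
  unfolding induced_chain_def
  by (auto intro!: tendsto_sum tendsto_mult tendsto_vec_nth assms)

text \<open>The maximising and minimising states are the same for all \<open>n\<close>, which lets
  the bounds be transported from state to state along limits of the chains: from the maximiser into
  \<open>C\<close> and through \<open>C\<close> by adversaries chosen freely, and from the minimiser into \<open>C\<close> by the limit of
  the replies \<open>p n\<close>, the only chains for which a lower bound on \<open>v\<close> is known.\<close>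

lemma bounded_span:
  fixes P :: "'s::finite \<Rightarrow> (real ^ 's ^ 'a::finite) set"
  assumes Q: "Q \<subseteq> prob_simplex" and P: "\<And>s. P s \<noteq> {}" "\<And>s. P s \<subseteq> transition_kernels"
    and D: "\<And>n s. D n s \<in> Q" "\<And>s. (\<lambda>n. D n s) \<longlonglongrightarrow> \<Delta> s" and p: "\<And>n s. p n s \<in> P s"
    and sub: "\<And>n p' s. p' \<in> Pi UNIV P \<Longrightarrow>
      v n s \<le> c + (\<Sum>y\<in>UNIV. induced_chain p' (D n) $ s $ y * v n y)"
    and super: "\<And>n s. (\<Sum>y\<in>UNIV. induced_chain (p n) (D n) $ s $ y * v n y) \<le> v n s + c"
    and max: "\<And>n s. v n s \<le> v n smax" and min: "\<And>n s. v n smin \<le> v n s"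
    and \<Delta>: "\<And>s. \<Delta> s \<in> prob_simplex" and C: "communicating_class P \<Delta> C"
    and lim: "C = UNIV \<or> (\<exists>p'\<in>Pi UNIV P. \<forall>s. (\<lambda>n. p n s) \<longlonglongrightarrow> p' s)"
  obtains K where "\<forall>\<^sub>F n in sequentially. \<forall>s t. v n s - v n t \<le> K"
proof -
  have st: "stochastic (induced_chain p' (D n))" if "p' \<in> Pi UNIV P" for p' n
    using that P D(1) Q by (intro stochastic_induced_chain) blast+
  have st\<Delta>: "stochastic (induced_chain p' \<Delta>)" if "p' \<in> Pi UNIV P" for p'
    using that P \<Delta> by (intro stochastic_induced_chain) blast+
  have reach: "\<exists>c\<in>C. \<exists>k. mat_power (induced_chain p' \<Delta>) k $ x $ c > 0"
    if p': "p' \<in> Pi UNIV P" for p' x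
  proof -
    have "transient (induced_chain p' \<Delta>) y" if "y \<notin> C" for y
      using C that p' unfolding communicating_class_def by simp
    then obtain c k where "c \<in> C" "mat_power (induced_chain p' \<Delta>) k $ x $ c > 0"
      by (rule reaches_complement_of_transient[OF st\<Delta>[OF p']])
    then show ?thesis
      by auto
  qed
  \<comment> \<open>The states at which \<open>v\<close> stays within a bounded distance below its maximum.\<close>
  define near_max where "near_max x \<longleftrightarrow> (\<exists>B. \<forall>\<^sub>F n in sequentially. v n smax - v n x \<le> B)" for x
  have near_max_step: "near_max y"
    if x: "near_max x" and p': "p' \<in> Pi UNIV P"
      and pos: "mat_power (induced_chain p' \<Delta>) k $ x $ y > 0" for p' k x y
  proof -
    from x obtain B where B: "\<forall>\<^sub>F n in sequentially. v n smax - v n x \<le> B"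
      by (auto simp: near_max_def)
    obtain B' where "\<forall>\<^sub>F n in sequentially. v n smax - v n y \<le> B'"
      by (rule bounded_deficit_propagates[where W = "\<lambda>n. induced_chain p' (D n)" and v = v
            and m = "\<lambda>n. v n smax", OF st[OF p']
            tendsto_induced_chain[OF tendsto_const D(2)] sub[OF p'] max pos B])
    then show ?thesis
      unfolding near_max_def by blast
  qed
  have near_max_smax: "near_max smax"
    unfolding near_max_def by (intro exI[of _ 0]) simp
  obtain p0 where p0: "p0 \<in> Pi UNIV P"
    using p[of 0] by blast
  obtain c0 where "c0 \<in> C" "near_max c0"
    using reach[OF p0] near_max_step[OF near_max_smax p0] by blast
  have near_max_C: "near_max c" if "c \<in> C" for c
  proof -
    obtain p' k where "p' \<in> Pi UNIV P" "mat_power (induced_chain p' \<Delta>) k $ c0 $ c > 0"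
      using C \<open>c0 \<in> C\<close> \<open>c \<in> C\<close> unfolding communicating_class_def by meson
    then show ?thesis
      using near_max_step[OF \<open>near_max c0\<close>] by simp
  qed
  have "\<exists>c\<in>C. \<exists>B. \<forall>\<^sub>F n in sequentially. v n c - v n smin \<le> B"
    using lim
  proof
    assume "C = UNIV"
    then show ?thesis
      by (intro bexI[of _ smin] exI[of _ 0]) auto
  next
    assume "\<exists>p'\<in>Pi UNIV P. \<forall>s. (\<lambda>n. p n s) \<longlonglongrightarrow> p' s"
    then obtain p' where p': "p' \<in> Pi UNIV P" "\<And>s. (\<lambda>n. p n s) \<longlonglongrightarrow> p' s"
      by blast
    obtain c' k where c': "c' \<in> C" "mat_power (induced_chain p' \<Delta>) k $ smin $ c' > 0"
      using reach[OF p'(1)] by blast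
    have neg: "- v n x \<le> c + (\<Sum>y\<in>UNIV. induced_chain (p n) (D n) $ x $ y * - v n y)" for n x
      using super[where n = n and s = x] by (simp add: sum_negf)
    have st': "stochastic (induced_chain (p n) (D n))" for n
      using p by (intro st) blast
    obtain B where "\<forall>\<^sub>F n in sequentially. - v n smin - (- v n c') \<le> B"
      by (rule bounded_deficit_propagates[where W = "\<lambda>n. induced_chain (p n) (D n)"
            and v = "\<lambda>n x. - v n x" and m = "\<lambda>n. - v n smin" and B = 0, OF st' tendsto_induced_chain[OF p'(2) D(2)] neg _ c'(2)])
        (use min in auto)
    then have "\<forall>\<^sub>F n in sequentially. v n c' - v n smin \<le> B"
      by simp
    with c'(1) show ?thesis
      by blast
  qed
  then obtain c1 B1 where c1: "c1 \<in> C" "\<forall>\<^sub>F n in sequentially. v n c1 - v n smin \<le> B1"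
    by blast
  obtain B2 where "\<forall>\<^sub>F n in sequentially. v n smax - v n c1 \<le> B2"
    using near_max_C[OF c1(1)] by (auto simp: near_max_def)
  with c1(2) have "\<forall>\<^sub>F n in sequentially. \<forall>s t. v n s - v n t \<le> B1 + B2"
  proof eventually_elim
    case (elim n)
    show ?case
    proof (intro allI)
      fix s t
      show "v n s - v n t \<le> B1 + B2"
        using max[of n s] min[of n t] elim by linarith
    qed
  qed
  then show thesis
    by (rule that)
qed

theorem theorem5:
  fixes r :: "'s::finite \<Rightarrow> 'a::finite \<Rightarrow> real"
    and Q :: "(real ^ 'a) set"
    and P :: "'s \<Rightarrow> (real ^ 's ^ 'a) set"
  assumes "\<And>s a. r s a \<in> {0..1}"
    and "Q \<noteq> {}" and "Q \<subseteq> prob_simplex"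
    and "\<And>s. P s \<noteq> {}" and "\<And>s. P s \<subseteq> transition_kernels"
    and "(weakly_communicating_controller Q P \<and> compact Q \<and> (\<forall>s. compact (P s))) \<or>
         (communicating_controller Q P \<and> compact Q)"
  shows "\<exists>(u :: 's \<Rightarrow> real) \<alpha>. \<alpha> \<in> {0..1} \<and>
    (\<forall>s. u s = (SUP \<phi>\<in>Q. INF q\<in>P s.
       \<Sum>a\<in>UNIV. \<Sum>s'\<in>UNIV. \<phi> $ a * q $ a $ s' * (r s a - \<alpha> + u s')))"
proof -
  note r = assms(1) and Q = assms(2,3) and P = assms(4,5) and comm = assms(6)
  let ?T = "bellman r Q P"
  define l where "l n = 1 - 1 / real (Suc n)" for n
  have l: "0 \<le> l n" "l n < 1" for n
    by (auto simp: l_def field_simps)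
  have lim_l: "l \<longlonglongrightarrow> 1"
    unfolding l_def using tendsto_diff[OF tendsto_const lim_1_over_n[THEN LIMSEQ_Suc]] by simp
  note top = topical_bellman[where r = r and Q = Q and P = P, OF r Q P]
  define near_opt where "near_opt n v \<Delta> p smax smin \<longleftrightarrow> (\<forall>s. v s \<in> {0..1 / (1 - l n)}) \<and> (\<forall>s. ?T (\<lambda>t. l n * v t) s = v s) \<and>
      (\<forall>s. \<Delta> s \<in> Q) \<and> (\<forall>s. p s \<in> P s) \<and>
      (\<forall>p'\<in>Pi UNIV P. \<forall>s. v s \<le> 2 + (\<Sum>y\<in>UNIV. induced_chain p' \<Delta> $ s $ y * v y)) \<and>
      (\<forall>s. (\<Sum>y\<in>UNIV. induced_chain p \<Delta> $ s $ y * v y) \<le> v s + 2) \<and>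
      (\<forall>s. v s \<le> v smax) \<and> (\<forall>s. v smin \<le> v s)"
    for n and v :: "'s \<Rightarrow> real" and \<Delta> p smax smin
  have "\<exists>v \<Delta> p smax smin. near_opt n v \<Delta> p smax smin" for n
  proof -
    obtain v where v: "\<And>s. v s \<in> {0..1 / (1 - l n)}" "\<And>s. ?T (\<lambda>t. l n * v t) s = v s"
      using topical_discounted_fixed_point[OF top bellman_zero_bounds[where r = r and Q = Q and P = P, OF r Q P] l[of n]]
      by blast
    obtain smax where smax: "\<And>s. v s \<le> v smax"
      using Max_in[of "range v"] Max_ge[of "range v"] by fastforce
    obtain smin where smin: "\<And>s. v smin \<le> v s"
      using Min_in[of "range v"] Min_le[of "range v"] by fastforce
    obtain \<Delta> p where "\<And>s. \<Delta> s \<in> Q" "\<And>s. p s \<in> P s"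
      "\<And>p' s. p' \<in> Pi UNIV P \<Longrightarrow> v s \<le> 2 + (\<Sum>y\<in>UNIV. induced_chain p' \<Delta> $ s $ y * v y)"
      "\<And>s. (\<Sum>y\<in>UNIV. induced_chain p \<Delta> $ s $ y * v y) \<le> v s + 2"
      by (rule near_optimal_policies[where r = r and Q = Q and P = P and l = "l n" and v = v,
            OF r Q P l v]) (rule that; assumption)
    with v smax smin have "near_opt n v \<Delta> p smax smin"
      by (simp add: near_opt_def)
    then show ?thesis
      by blast
  qed
  then obtain v D p smax smin where near_opt: "\<And>n. near_opt n (v n) (D n) (p n) (smax n) (smin n)"
    by metis
  have v: "\<And>n s. v n s \<in> {0..1 / (1 - l n)}" "\<And>n s. ?T (\<lambda>t. l n * v n t) s = v n s"
    and D: "\<And>n s. D n s \<in> Q" and p: "\<And>n s. p n s \<in> P s"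
    and sub: "\<And>n p' s. p' \<in> Pi UNIV P \<Longrightarrow>
      v n s \<le> 2 + (\<Sum>y\<in>UNIV. induced_chain p' (D n) $ s $ y * v n y)"
    and super: "\<And>n s. (\<Sum>y\<in>UNIV. induced_chain (p n) (D n) $ s $ y * v n y) \<le> v n s + 2"
    and max: "\<And>n s. v n s \<le> v n (smax n)" and min: "\<And>n s. v n (smin n) \<le> v n s"
    using near_opt unfolding near_opt_def by simp_all
  \<comment> \<open>Three successive subsequences: along the first the maximiser and the minimiser are constant,
    along the second the controller policies converge, and along the third, in the weakly
    communicating case, the adversary replies converge as well.\<close>
  obtain g1 :: "nat \<Rightarrow> nat" and smaxmin where g1: "strict_mono g1" "\<And>n. (smax (g1 n), smin (g1 n)) = smaxmin"
    using constant_subsequence[of "\<lambda>n. (smax n, smin n)"] by blast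
  obtain g2 \<Delta> where g2: "strict_mono g2" and \<Delta>: "\<And>s. \<Delta> s \<in> Q"
    and lim_D: "\<And>s. (\<lambda>n. D (g1 (g2 n)) s) \<longlonglongrightarrow> \<Delta> s"
    using finite_family_convergent_subseq[of "\<lambda>_. Q" "\<lambda>n. D (g1 n)"] comm D by metis
  have "\<exists>(g3 :: nat \<Rightarrow> nat) C. strict_mono g3 \<and> communicating_class P \<Delta> C \<and>
      (C = UNIV \<or> (\<exists>p'\<in>Pi UNIV P. \<forall>s. (\<lambda>n. p (g1 (g2 (g3 n))) s) \<longlonglongrightarrow> p' s))"
    using comm
  proof
    assume *: "weakly_communicating_controller Q P \<and> compact Q \<and> (\<forall>s. compact (P s))"
    have "\<Delta> \<in> UNIV \<rightarrow> Q"
      using \<Delta> by simp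
    with * obtain C where "communicating_class P \<Delta> C"
      unfolding weakly_communicating_controller_def weakly_communicating_policy_def by blast
    moreover obtain g3 p' where "strict_mono g3" "\<And>s. p' s \<in> P s"
      "\<And>s. (\<lambda>n. p (g1 (g2 (g3 n))) s) \<longlonglongrightarrow> p' s"
      using finite_family_convergent_subseq[of P "\<lambda>n. p (g1 (g2 n))"] * p by metis
    ultimately show ?thesis
      by blast
  next
    assume "communicating_controller Q P \<and> compact Q"
    then have "communicating_class P \<Delta> UNIV"
      using \<Delta> by (auto simp: communicating_controller_def communicating_policy_def Pi_iff)
    then show ?thesis
      using strict_mono_id by blast
  qed
  then obtain g3 C where g3: "strict_mono g3" and C: "communicating_class P \<Delta> C"
    and lim_p: "C = UNIV \<or> (\<exists>p'\<in>Pi UNIV P. \<forall>s. (\<lambda>n. p (g1 (g2 (g3 n))) s) \<longlonglongrightarrow> p' s)"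
    by blast
  define g where "g = g1 \<circ> g2 \<circ> g3"
  have g: "strict_mono g"
    unfolding g_def by (intro strict_mono_o g1 g2 g3)
  have lim_Dg: "(\<lambda>n. D (g n) s) \<longlonglongrightarrow> \<Delta> s" for s
    using LIMSEQ_subseq_LIMSEQ[OF lim_D g3] by (simp add: g_def o_def)
  have ext: "smax (g n) = fst smaxmin" "smin (g n) = snd smaxmin" for n
    using g1(2)[of "g2 (g3 n)"] by (auto simp: g_def)
  have maxg: "v (g n) s \<le> v (g n) (fst smaxmin)" and ming: "v (g n) (snd smaxmin) \<le> v (g n) s" for n s
    using max[of "g n" s] min[of "g n" s] by (simp_all add: ext)
  have \<Delta>': "\<Delta> s \<in> prob_simplex" for s
    using \<Delta> Q by blast
  have lim_pg: "C = UNIV \<or> (\<exists>p'\<in>Pi UNIV P. \<forall>s. (\<lambda>n. p (g n) s) \<longlonglongrightarrow> p' s)"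
    using lim_p by (simp add: g_def)
  obtain K where K: "\<forall>\<^sub>F n in sequentially. \<forall>s t. v (g n) s - v (g n) t \<le> K"
    by (rule bounded_span[OF Q(2) P D lim_Dg p sub super maxg ming \<Delta>' C lim_pg])
  have "(\<lambda>n. l (g n)) \<longlonglongrightarrow> 1"
    using LIMSEQ_subseq_LIMSEQ[OF lim_l g] by (simp add: o_def)
  from topical_eigenvector_vanishing_discount[OF top l(2) this v K]
  obtain u \<alpha> where u: "\<alpha> \<in> {0..1}" "\<And>s. ?T (\<lambda>t. u t - \<alpha>) s = u s"
    by blast
  have "r s a + (u s' - \<alpha>) = r s a - \<alpha> + u s'" for s a s'
    by simp
  with u show ?thesis
    unfolding bellman_def payoff_def by (intro exI[of _ u] exI[of _ \<alpha>]) simp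
qed

end
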